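(* No online rule always satisfies all-rank-wJR on static strict one-dimensional Euclidean profiles. This holds with fifteen voters, fifteen candidates, a common candidate axis, and a common single-crossing voter order.
   Context: Model. Voters $V=[n]$, a set $C$ of $m$ candidates, rounds $T=\{1,\dots,|T|\}$ with $n,m,|T|\ge1$; $|T|$ is the horizon. In each round $j$ each voter $i$ has a strict complete ranking of $C$; a profile consists of all rankings and is static if they are the same in all rounds. For $r\in[m]$, $A_i^j(r)$ is the set of voter $i$'s $r$ most-preferred candidates in round $j$. A group is a nonempty $S\subseteq V$. A (deterministic) rule maps each input to a sequence $W=(w^1,\dots,w^{|T|})\in C^{|T|}$; it is online if each $w^j$ depends only on the rankings in rounds $1,\dots,j$ (besides $V$ and $C$) and not on $|T|$. A rule always satisfies an axiom on a class of profiles if its output satisfies the axiom for every input in the class, at every horizon. Domains. A profile is strict one-dimensional Euclidean if, in each round, voters and candidates can be placed on the real line so that every voter ranks the candidates by increasing distance from her position, with no ties in distance. Rankings in a round are single-peaked with respect to a linear order (axis) of $C$ if, for every voter, candidates are ranked lower as one moves away from her first choice along the axis in either direction; they are single-crossing with respect to a linear order of $V$ if, for every pair of candidates $a,b$, the voters preferring $a$ to $b$ form a prefix or a suffix of that order. "Common" means the same axis / order for all rounds. All-rank-wJR. $W$ satisfies all-rank-wJR if, for every rank matrix $R=(r_i^j)\in[m]^{|T|\times n}$ and every group $S$ with $|S|\ge n/|T|$ such that $\bigcap_{i\in S}A_i^j(r_i^j)\ne\varnothing$ for all $j\in T$, there is at least one round $j$ with $w^j\in\bigcup_{i\in S}A_i^j(r_i^j)$.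 *)

theory Defs
  imports Complex_Main "HOL-Combinatorics.Multiset_Permutations"
begin

text \<open>
  Voters are \<open>{1..n}\<close> and rounds are \<open>{1..T}\<close>. A strict complete ranking of the finite
  candidate set \<open>C\<close> is the list of its elements from best to worst, i.e. a member of
  \<^term>\<open>permutations_of_set C\<close>; linear orders of candidates (axes) and of voters are
  represented in the same way. A profile maps a round and a voter to a ranking; its values outside
  \<open>{1..T} \<times> {1..n}\<close> carry no meaning.
\<close>

type_synonym 'c profile = "nat \<Rightarrow> nat \<Rightarrow> 'c list"

definition is_profile :: "nat \<Rightarrow> 'c set \<Rightarrow> nat \<Rightarrow> 'c profile \<Rightarrow> bool" where
  "is_profile n C T P \<longleftrightarrow>
     n \<ge> 1 \<and> finite C \<and> C \<noteq> {} \<and> T \<ge> 1 \<and>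
     (\<forall>j\<in>{1..T}. \<forall>i\<in>{1..n}. P j i \<in> permutations_of_set C)"

definition top_set :: "'c profile \<Rightarrow> nat \<Rightarrow> nat \<Rightarrow> nat \<Rightarrow> 'c set" where
  "top_set P j i r = set (take r (P j i))"

definition before :: "'a list \<Rightarrow> 'a \<Rightarrow> 'a \<Rightarrow> bool" where
  "before xs a b \<longleftrightarrow> (\<exists>k l. k < l \<and> l < length xs \<and> xs ! k = a \<and> xs ! l = b)"

definition static_profile :: "nat \<Rightarrow> nat \<Rightarrow> 'c profile \<Rightarrow> bool" where
  "static_profile n T P \<longleftrightarrow>
     (\<forall>j\<in>{1..T}. \<forall>k\<in>{1..T}. \<forall>i\<in>{1..n}. P j i = P k i)"

text \<open>Strict sortedness by distance also rules out ties, and the placement may differ per round.\<close>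

definition strict_euclidean :: "nat \<Rightarrow> nat \<Rightarrow> 'c profile \<Rightarrow> bool" where
  "strict_euclidean n T P \<longleftrightarrow>
     (\<forall>j\<in>{1..T}. \<exists>(x :: nat \<Rightarrow> real) (y :: 'c \<Rightarrow> real). \<forall>i\<in>{1..n}.
        sorted_wrt (\<lambda>a b. \<bar>x i - y a\<bar> < \<bar>x i - y b\<bar>) (P j i))"

definition single_peaked_wrt :: "'c list \<Rightarrow> 'c list \<Rightarrow> bool" where
  "single_peaked_wrt ax xs \<longleftrightarrow>
     (\<forall>a b. (a = hd xs \<or> before ax (hd xs) a) \<and> before ax a b \<longrightarrow> before xs a b) \<and>
     (\<forall>a b. (a = hd xs \<or> before ax a (hd xs)) \<and> before ax b a \<longrightarrow> before xs a b)"

definition common_axis :: "nat \<Rightarrow> 'c set \<Rightarrow> nat \<Rightarrow> 'c profile \<Rightarrow> bool" where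
  "common_axis n C T P \<longleftrightarrow>
     (\<exists>ax\<in>permutations_of_set C. \<forall>j\<in>{1..T}. \<forall>i\<in>{1..n}. single_peaked_wrt ax (P j i))"

definition common_single_crossing :: "nat \<Rightarrow> 'c set \<Rightarrow> nat \<Rightarrow> 'c profile \<Rightarrow> bool" where
  "common_single_crossing n C T P \<longleftrightarrow>
     (\<exists>vo\<in>permutations_of_set {1..n}. \<forall>j\<in>{1..T}. \<forall>a\<in>C. \<forall>b\<in>C. \<exists>k.
        {i\<in>{1..n}. before (P j i) a b} = set (take k vo) \<or>
        {i\<in>{1..n}. before (P j i) a b} = set (drop k vo))"

definition all_rank_wJR ::
  "nat \<Rightarrow> 'c set \<Rightarrow> nat \<Rightarrow> 'c profile \<Rightarrow> (nat \<Rightarrow> 'c) \<Rightarrow> bool" where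
  "all_rank_wJR n C T P W \<longleftrightarrow>
     (\<forall>(R :: nat \<Rightarrow> nat \<Rightarrow> nat) S.
        (\<forall>j\<in>{1..T}. \<forall>i\<in>{1..n}. R j i \<in> {1..card C}) \<and>
        S \<subseteq> {1..n} \<and> S \<noteq> {} \<and> real (card S) \<ge> real n / real T \<and>
        (\<forall>j\<in>{1..T}. (\<Inter>i\<in>S. top_set P j i (R j i)) \<noteq> {}) \<longrightarrow>
        (\<exists>j\<in>{1..T}. W j \<in> (\<Union>i\<in>S. top_set P j i (R j i))))"

text \<open>
  A rule maps an input \<open>(n, C, T, P)\<close> to an outcome sequence, of which only the entries in
  \<open>{1..T}\<close> matter.
\<close>

type_synonym 'c rule = "nat \<Rightarrow> 'c set \<Rightarrow> nat \<Rightarrow> 'c profile \<Rightarrow> nat \<Rightarrow> 'c"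

definition is_rule :: "'c rule \<Rightarrow> bool" where
  "is_rule F \<longleftrightarrow>
     (\<forall>n C T P. is_profile n C T P \<longrightarrow> (\<forall>j\<in>{1..T}. F n C T P j \<in> C))"

text \<open>
  Taking \<open>T = T'\<close> below, an online rule also ignores the meaningless values of a profile.
\<close>

definition online :: "'c rule \<Rightarrow> bool" where
  "online F \<longleftrightarrow>
     (\<forall>n C T T' P P' j.
        is_profile n C T P \<and> is_profile n C T' P' \<and> j \<in> {1..T} \<and> j \<in> {1..T'} \<and>
        (\<forall>k\<in>{1..j}. \<forall>i\<in>{1..n}. P k i = P' k i) \<longrightarrow>
        F n C T P j = F n C T' P' j)"

definition always_satisfies ::
  "'c rule \<Rightarrow> (nat \<Rightarrow> 'c set \<Rightarrow> nat \<Rightarrow> 'c profile \<Rightarrow> (nat \<Rightarrow> 'c) \<Rightarrow> bool)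
     \<Rightarrow> (nat \<Rightarrow> 'c set \<Rightarrow> nat \<Rightarrow> 'c profile \<Rightarrow> bool) \<Rightarrow> bool" where
  "always_satisfies F Ax D \<longleftrightarrow>
     (\<forall>n C T P. is_profile n C T P \<and> D n C T P \<longrightarrow> Ax n C T P (F n C T P))"

end

theory Submission imports Defs begin

text \<open>
  Place voter \<open>i\<close> at \<open>i\<close> and candidate \<open>i\<close> at \<open>i + 1/4\<close>. Voters \<open>l, \<dots>, u\<close> unanimously prefer
  candidate \<open>l\<close> to everything on its left and candidate \<open>u\<close> to everything on its right, so
  all-rank-wJR at horizon \<open>T\<close> forces the first \<open>T\<close> choices to hit every window of \<open>k\<close> consecutive
  positions with \<open>k T \<ge> n\<close>. On a static profile the choices of an online rule at different horizons
  are prefixes of one sequence, and for \<open>n = 15\<close> no sequence hits all windows of lengths 5, 4, 3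
  with its first 3, 4, 5 entries.
\<close>

section \<open>Rankings obtained by sorting along an injective key\<close>

lemma before_sort_key:
  fixes f :: "'a \<Rightarrow> 'b::linorder"
  assumes "inj_on f (set ys)" "distinct ys"
  shows "before (sort_key f ys) a b \<longleftrightarrow> a \<in> set ys \<and> b \<in> set ys \<and> f a < f b"
proof
  let ?xs = "sort_key f ys"
  have sorted: "sorted (map f ?xs)" by simp
  have mono: "f (?xs ! k) \<le> f (?xs ! l)" if "k \<le> l" "l < length ?xs" for k l
    using sorted_nth_mono[OF sorted, of k l] that by simp
  {
    assume "before ?xs a b"
    then obtain k l where kl: "k < l" "l < length ?xs" "?xs ! k = a" "?xs ! l = b"
      unfolding before_def by blast
    have ab: "a \<in> set ys" "b \<in> set ys"
      using kl nth_mem[of k ?xs] nth_mem[of l ?xs] by auto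
    have "a \<noteq> b"
      using kl assms(2) nth_eq_iff_index_eq[of ?xs k l] by auto
    then have "f a \<noteq> f b" using ab assms(1) by (auto dest: inj_onD)
    then show "a \<in> set ys \<and> b \<in> set ys \<and> f a < f b"
      using ab mono[of k l] kl by auto
  }
  assume ab: "a \<in> set ys \<and> b \<in> set ys \<and> f a < f b"
  then have "a \<in> set ?xs" "b \<in> set ?xs" by simp_all
  then obtain k l where kl: "k < length ?xs" "?xs ! k = a" "l < length ?xs" "?xs ! l = b"
    by (metis in_set_conv_nth)
  have "k < l" using mono[of l k] kl ab by (force simp: not_less[symmetric])
  then show "before ?xs a b" using kl unfolding before_def by blast
qed

lemma sorted_wrt_sort_key_less:
  fixes f :: "'a \<Rightarrow> 'b::linorder"
  assumes "inj_on f (set ys)" "distinct ys"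
  shows "sorted_wrt (\<lambda>a b. f a < f b) (sort_key f ys)"
proof -
  have "before (sort_key f ys) (sort_key f ys ! k) (sort_key f ys ! l)"
    if "k < l" "l < length ys" for k l
    using that unfolding before_def by auto
  then show ?thesis
    by (auto simp: sorted_wrt_iff_nth_less before_sort_key[OF assms])
qed

lemma hd_sort_key:
  fixes f :: "'a \<Rightarrow> 'b::linorder"
  assumes "c \<in> set ys" "\<And>b. b \<in> set ys \<Longrightarrow> b \<noteq> c \<Longrightarrow> f c < f b"
  shows "hd (sort_key f ys) = c"
proof -
  let ?xs = "sort_key f ys"
  have c: "c \<in> set ?xs" using assms(1) by simp
  then obtain x zs where xs: "?xs = x # zs" by (cases ?xs) auto
  have "sorted (map f (x # zs))" by (metis xs sorted_sort_key)
  then have "f x \<le> f c" using c xs by auto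
  moreover have "x \<in> set ys" using arg_cong[OF xs, of set] by auto
  ultimately show ?thesis using assms(2)[of x] xs by force
qed

text \<open>Turns a threshold on the key into a legal rank: cutting the list just after
  \<open>c\<close> leaves exactly the elements whose key is at most that of \<open>c\<close>.
  Entries of the rank matrix are chosen this way.\<close>

lemma take_sort_key_eq:
  fixes f :: "'a \<Rightarrow> 'b::linorder"
  assumes "inj_on f (set ys)" "distinct ys" "c \<in> set ys"
  shows "\<exists>r\<in>{1..length ys}. set (take r (sort_key f ys)) = {x \<in> set ys. f x \<le> f c}"
proof -
  let ?xs = "sort_key f ys"
  have "c \<in> set ?xs" using assms by simp
  then obtain us vs where xs: "?xs = us @ c # vs" by (meson split_list)
  have s: "sorted_wrt (\<lambda>a b. f a < f b) (us @ c # vs)"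
    using sorted_wrt_sort_key_less[OF assms(1,2)] xs by simp
  have set: "set ys = set us \<union> {c} \<union> set vs" using arg_cong[OF xs, of set] by auto
  have "set (take (Suc (length us)) ?xs) = {x \<in> set ys. f x \<le> f c}"
    using s unfolding xs set by (force simp: sorted_wrt_append)
  moreover have "Suc (length us) \<in> {1..length ys}"
    using arg_cong[OF xs, of length] by auto
  ultimately show ?thesis by blast
qed

section \<open>Distances between integer voters and shifted candidates\<close>

text \<open>The offset \<open>1/4\<close> makes all distances from an integer point distinct.\<close>

definition distance :: "('c \<Rightarrow> nat) \<Rightarrow> nat \<Rightarrow> 'c \<Rightarrow> real" where
  "distance pos i c = \<bar>real i - (real (pos c) + 1 / 4)\<bar>"

lemma distance_inj_on:
  assumes "inj_on pos C"
  shows "inj_on (distance pos i) C"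
proof (rule inj_onI)
  fix a b assume ab: "a \<in> C" "b \<in> C" and "distance pos i a = distance pos i b"
  \<comment> \<open>The second case puts the voter at the midpoint of the two candidates; scaled by
    4, this equates an even and an odd number.\<close>
  then consider "real (pos a) = real (pos b)" | "4 * int i = 2 * int (pos a) + 2 * int (pos b) + 1"
    unfolding distance_def by linarith
  then have "pos a = pos b" by cases (simp, presburger)
  then show "a = b" using assms ab by (auto dest: inj_onD)
qed

text \<open>The midpoint of the two candidates is \<open>(pos a + pos b) / 2 + 1 / 4\<close>, which
  exceeds its floor by 1/4 or 3/4, so integer voters are separated by that floor.\<close>

lemma distance_less_right:
  assumes "pos a < pos b"
  shows "distance pos i a < distance pos i b \<longleftrightarrow> i \<le> (pos a + pos b) div 2"
proof -
  have "distance pos i a < distance pos i b \<longleftrightarrow>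
      4 * int i < 2 * int (pos a) + 2 * int (pos b) + 1"
    using assms unfolding distance_def by linarith
  then show ?thesis by presburger
qed

lemma distance_less_left:
  assumes "pos b < pos a"
  shows "distance pos i a < distance pos i b \<longleftrightarrow> (pos a + pos b) div 2 < i"
proof -
  have "distance pos i a < distance pos i b \<longleftrightarrow>
      2 * int (pos a) + 2 * int (pos b) + 1 < 4 * int i"
    using assms unfolding distance_def by linarith
  then show ?thesis by presburger
qed

lemmas distance_less = distance_less_right distance_less_left

section \<open>The static line profile and its structural properties\<close>

locale line_profile =
  fixes n :: nat and pos :: "'c \<Rightarrow> nat" and ys :: "'c list"
  assumes n_pos: "n \<ge> 1" and distinct: "distinct ys" and bij: "bij_betw pos (set ys) {1..n}"
begin

definition P :: "'c profile" where
  "P j i = sort_key (distance pos i) ys"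

lemma inj: "inj_on pos (set ys)"
  using bij by (rule bij_betw_imp_inj_on)

lemma candidate_at:
  assumes "i \<in> {1..n}"
  obtains c where "c \<in> set ys" "pos c = i"
  using bij assms unfolding bij_betw_def by (metis imageE)

lemma length_ys: "length ys = n"
  using bij_betw_same_card[OF bij] distinct_card[OF distinct] by simp

lemma before_P:
  "before (P j i) a b \<longleftrightarrow> a \<in> set ys \<and> b \<in> set ys \<and> distance pos i a < distance pos i b"
  unfolding P_def by (rule before_sort_key[OF distance_inj_on[OF inj] distinct])

lemma is_profile:
  assumes "T \<ge> 1"
  shows "is_profile n (set ys) T P"
  using assms n_pos distinct length_ys
  by (auto simp: is_profile_def P_def permutations_of_set_def)

lemma static: "static_profile n T P"
  by (simp add: static_profile_def P_def)

lemma euclidean: "strict_euclidean n T P"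
  unfolding strict_euclidean_def P_def
  using sorted_wrt_sort_key_less[OF distance_inj_on[OF inj] distinct]
  unfolding distance_def by (intro ballI exI[of _ real] exI[of _ "\<lambda>c. real (pos c) + 1 / 4"])

lemma common_axis: "common_axis n (set ys) T P"
proof -
  let ?ax = "sort_key pos ys"
  have ax: "before ?ax a b \<longleftrightarrow> a \<in> set ys \<and> b \<in> set ys \<and> pos a < pos b" for a b
    by (rule before_sort_key[OF inj distinct])
  have "single_peaked_wrt ?ax (P j i)" if i: "i \<in> {1..n}" for i j
  proof -
    obtain c where c: "c \<in> set ys" "pos c = i" using candidate_at i by blast
    \<comment> \<open>Voter \<open>i\<close> is at distance 1/4 from candidate \<open>c\<close> and
      at least 3/4 from every other one.\<close>
    have "distance pos i c < distance pos i b" if "b \<in> set ys" "b \<noteq> c" for b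
    proof -
      have "pos b \<noteq> i" using that c inj by (auto dest: inj_onD)
      then show ?thesis unfolding distance_def c(2) by linarith
    qed
    then have hd: "hd (P j i) = c" unfolding P_def using c by (intro hd_sort_key)
    show ?thesis
      unfolding single_peaked_wrt_def hd before_P ax using c
      by (auto simp: distance_less)
  qed
  then show ?thesis
    unfolding common_axis_def using distinct
    by (intro bexI[of _ ?ax]) (auto simp: permutations_of_set_def)
qed

lemma common_single_crossing: "common_single_crossing n (set ys) T P"
proof -
  let ?vo = "[1..<Suc n]"
  have pre: "set (take k ?vo) = {i \<in> {1..n}. i \<le> k}" for k
    by (cases "k \<le> n") (auto simp: take_upt simp del: upt_Suc)
  have suf: "set (drop k ?vo) = {i \<in> {1..n}. k < i}" for k
    by (auto simp: drop_upt simp del: upt_Suc)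
  have "\<exists>k. {i \<in> {1..n}. before (P j i) a b} = set (take k ?vo) \<or>
      {i \<in> {1..n}. before (P j i) a b} = set (drop k ?vo)"
    if ab: "a \<in> set ys" "b \<in> set ys" for a b j
  proof (cases "pos a" "pos b" rule: linorder_cases)
    case less
    then show ?thesis unfolding pre suf before_P using ab
      by (auto simp: distance_less intro!: exI[of _ "(pos a + pos b) div 2"])
  next
    case equal
    then show ?thesis unfolding pre suf before_P
      by (auto simp: distance_def intro!: exI[of _ 0])
  next
    case greater
    then show ?thesis unfolding pre suf before_P using ab
      by (auto simp: distance_less intro!: exI[of _ "(pos a + pos b) div 2"])
  qed
  then show ?thesis
    unfolding common_single_crossing_def
    by (intro bexI[of _ ?vo]) (auto simp: permutations_of_set_def)
qed

text \<open>The witness is the candidate at the window's end nearer to \<open>w\<close>. It does not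
  depend on the voter, so it can serve as a commonly approved candidate.\<close>

lemma outside_window_dominated:
  assumes "l \<in> {1..n}" "u \<in> {1..n}" "pos w \<notin> {l..u}"
  shows "\<exists>c\<in>set ys. \<forall>i\<in>{l..u}. distance pos i c < distance pos i w"
proof -
  obtain c d where c: "c \<in> set ys" "pos c = l" and d: "d \<in> set ys" "pos d = u"
    using candidate_at assms by metis
  show ?thesis
  proof (cases "pos w < l")
    case True
    then have "\<forall>i\<in>{l..u}. distance pos i c < distance pos i w"
      using c by (auto simp: distance_less_left)
    then show ?thesis using c by blast
  next
    case False
    then have "\<forall>i\<in>{l..u}. distance pos i d < distance pos i w"
      using assms d by (auto simp: distance_less_right)
    then show ?thesis using d by blast
  qed
qed

text \<open>If the window were missed, its voters would form a group violating the axiom: in each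
  round every member approves down to a common candidate that all of them prefer to the
  winner.\<close>

lemma window_hit:
  assumes wJR: "all_rank_wJR n (set ys) T P W" and T: "T \<ge> 1"
    and l: "l \<in> {1..n}" and u: "u \<in> {l..n}" and size: "n \<le> (Suc u - l) * T"
  shows "\<exists>j\<in>{1..T}. pos (W j) \<in> {l..u}"
proof (rule ccontr)
  assume "\<not> ?thesis"
  then have "\<forall>j\<in>{1..T}. \<exists>c\<in>set ys. \<forall>i\<in>{l..u}. distance pos i c < distance pos i (W j)"
    using l u by (auto intro!: outside_window_dominated)
  then obtain c where c: "\<And>j. j \<in> {1..T} \<Longrightarrow> c j \<in> set ys"
    "\<And>j i. j \<in> {1..T} \<Longrightarrow> i \<in> {l..u} \<Longrightarrow> distance pos i (c j) < distance pos i (W j)"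
    by metis
  \<comment> \<open>\<open>r\<close> is the rank of \<open>c j\<close> for voter \<open>i\<close>.
    The resulting top sets all contain \<open>c j\<close>, while for \<open>i\<close> in the window
    none contains \<open>W j\<close>.\<close>
  have "\<exists>r. j \<in> {1..T} \<longrightarrow> r \<in> {1..n} \<and>
      top_set P j i r = {x \<in> set ys. distance pos i x \<le> distance pos i (c j)}" for j i
    using take_sort_key_eq[OF distance_inj_on[OF inj] distinct c(1)]
    unfolding top_set_def P_def length_ys by blast
  then obtain R where R: "\<And>j i. j \<in> {1..T} \<Longrightarrow> R j i \<in> {1..n}"
    "\<And>j i. j \<in> {1..T} \<Longrightarrow>
      top_set P j i (R j i) = {x \<in> set ys. distance pos i x \<le> distance pos i (c j)}"
    by metis
  have "real n \<le> real (card {l..u}) * real T"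
    using size by (simp flip: of_nat_mult)
  then have "real n / real T \<le> real (card {l..u})"
    using T by (simp add: divide_le_eq)
  moreover have "\<forall>j\<in>{1..T}. (\<Inter>i\<in>{l..u}. top_set P j i (R j i)) \<noteq> {}"
    using R(2) c(1) by fastforce
  moreover have "\<forall>j\<in>{1..T}. \<forall>i\<in>{1..n}. R j i \<in> {1..card (set ys)}"
    using R(1) length_ys distinct_card[OF distinct] by simp
  moreover have "{l..u} \<subseteq> {1..n}" "{l..u} \<noteq> {}"
    using l u by auto
  ultimately have "\<exists>j\<in>{1..T}. W j \<in> (\<Union>i\<in>{l..u}. top_set P j i (R j i))"
    using wJR[unfolded all_rank_wJR_def, THEN spec[of _ R], THEN spec[of _ "{l..u}"]] by blast
  then obtain j i where "j \<in> {1..T}" "i \<in> {l..u}" "W j \<in> top_set P j i (R j i)" by blast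
  then show False using R(2)[of j i] c(2)[of j i] by simp
qed

end

section \<open>The combinatorial core: no sequence hits all windows\<close>

text \<open>
  The five entries lie one in each of the blocks \<open>{1..3}, \<dots>, {13..15}\<close>. Deleting the fifth entry
  must leave every window of length 4 hit, which pins the other four down to \<open>(4, 7, 10, 13)\<close>,
  \<open>(3, 7, 10, 13)\<close>, \<open>(3, 6, 10, 13)\<close>, \<open>(3, 6, 9, 13)\<close> or \<open>(3, 6, 9, 12)\<close>; deleting any entry of
  these leaves a window of length 5 unhit.
\<close>

lemma windows_not_all_hit:
  fixes w :: "nat \<Rightarrow> nat"
  assumes hit: "\<And>T l. T \<in> {3, 4, 5} \<Longrightarrow> l \<in> {1..8 + T} \<Longrightarrow>
      \<exists>j\<in>{1..T}. w j \<in> {l..l + (7 - T)}"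
  shows False
proof -
  define A where "A T = w ` {1..T}" for T
  have hit_A: "\<exists>x\<in>A T. l \<le> x \<and> x \<le> l + (7 - T)" if "T \<in> {3, 4, 5}" "l \<in> {1..8 + T}" for T l
    using hit[OF that] unfolding A_def by auto
  have card: "card (A T) \<le> T" for T
    using card_image_le[of "{1..T}" w] unfolding A_def by simp
  have finite: "finite (A T)" for T unfolding A_def by simp
  \<comment> \<open>The blocks are five disjoint windows of length 3. Since \<open>A 5\<close> has
    at most five elements, it consists of one element per block.\<close>
  obtain p q r s t where mem: "{p, q, r, s, t} \<subseteq> A 5"
    and block: "p \<in> {1..3}" "q \<in> {4..6}" "r \<in> {7..9}" "s \<in> {10..12}" "t \<in> {13..15}"
    using hit_A[of 5 1] hit_A[of 5 4] hit_A[of 5 7] hit_A[of 5 10] hit_A[of 5 13] by auto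
  define B where "B = {p, q, r, s, t}"
  have card_B: "card B = 5" using block unfolding B_def by simp
  have A5: "A 5 = B"
    using card_seteq[OF finite mem] card[of 5] card_B unfolding B_def by simp
  have sub: "A 3 \<subseteq> A 4" "A 4 \<subseteq> B" unfolding A5[symmetric] A_def by auto
  \<comment> \<open>By counting, \<open>A 4\<close> misses some \<open>x\<close> of
    \<open>B\<close>, and \<open>A 3\<close> a further \<open>y\<close>. Hitting a window is
    monotone, so the supersets \<open>B - {x}\<close> and \<open>B - {x} - {y}\<close> inherit the
    hits.\<close>
  have "\<not> B \<subseteq> A 4"
    using card_B card[of 4] card_mono[OF finite, of B 4] by auto
  then obtain x where x: "x \<in> B" "A 4 \<subseteq> B - {x}" using sub by blast
  have "card (B - {x}) = 4" using x card_B by simp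
  then have "\<not> B - {x} \<subseteq> A 3"
    using card[of 3] card_mono[OF finite, of "B - {x}" 3] by auto
  then obtain y where y: "y \<in> B - {x}" "A 3 \<subseteq> B - {x} - {y}" using sub x by blast
  have h5: "\<exists>z\<in>B. l \<le> z \<and> z \<le> l + 2" if "l \<in> {1..13}" for l
    using hit_A[of 5 l] that A5 by simp
  have h4: "\<exists>z\<in>B - {x}. l \<le> z \<and> z \<le> l + 3" if "l \<in> {1..12}" for l
  proof -
    have "\<exists>z\<in>A 4. l \<le> z \<and> z \<le> l + 3" using hit_A[of 4 l] that by simp
    then show ?thesis using x(2) by blast
  qed
  have h3: "\<exists>z\<in>B - {x} - {y}. l \<le> z \<and> z \<le> l + 4" if "l \<in> {1..11}" for l
  proof -
    have "\<exists>z\<in>A 3. l \<le> z \<and> z \<le> l + 4" using hit_A[of 3 l] that by simp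
    then show ?thesis using y(2) by blast
  qed
  \<comment> \<open>The window of length 3 starting right after an entry must contain the next
    one.\<close>
  have gap: "q \<le> p + 3" "r \<le> q + 3" "s \<le> r + 3" "t \<le> s + 3"
    using h5[of "p + 1"] h5[of "q + 1"] h5[of "r + 1"] h5[of "s + 1"] block
    unfolding B_def by auto
  consider "x = p" | "x = q" | "x = r" | "x = s" | "x = t"
    using x(1) unfolding B_def by blast
  then consider "B - {x} = {4, 7, 10, 13}" | "B - {x} = {3, 7, 10, 13}"
    | "B - {x} = {3, 6, 10, 13}" | "B - {x} = {3, 6, 9, 13}" | "B - {x} = {3, 6, 9, 12}"
  proof cases
    case 1
    then have "q = 4" "r = 7" "s = 10" "t = 13"
      using h4[of 1] gap block unfolding B_def by auto
    then have "B - {x} = {4, 7, 10, 13}" using 1 block unfolding B_def by auto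
    then show ?thesis by (rule that(1))
  \<comment> \<open>With an inner entry deleted, its two neighbours can be at most 4 apart, which
    forces them to the facing ends of their blocks. The gap bounds then propagate outwards.\<close>
  next
    case 2
    then have "p = 3" "r = 7" "s = 10" "t = 13"
      using h4[of "p + 1"] gap block unfolding B_def by auto
    then have "B - {x} = {3, 7, 10, 13}" using 2 block unfolding B_def by auto
    then show ?thesis by (rule that(2))
  next
    case 3
    then have "p = 3" "q = 6" "s = 10" "t = 13"
      using h4[of "q + 1"] gap block unfolding B_def by auto
    then have "B - {x} = {3, 6, 10, 13}" using 3 block unfolding B_def by auto
    then show ?thesis by (rule that(3))
  next
    case 4
    then have "p = 3" "q = 6" "r = 9" "t = 13"
      using h4[of "r + 1"] gap block unfolding B_def by auto
    then have "B - {x} = {3, 6, 9, 13}" using 4 block unfolding B_def by auto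
    then show ?thesis by (rule that(4))
  next
    case 5
    then have "p = 3" "q = 6" "r = 9" "s = 12"
      using h4[of 12] gap block unfolding B_def by auto
    then have "B - {x} = {3, 6, 9, 12}" using 5 block unfolding B_def by auto
    then show ?thesis by (rule that(5))
  qed
  then show False
  proof cases
    case 1
    \<comment> \<open>Each of the four windows of length 5 contains exactly one of the four
      elements, so deleting \<open>y\<close> leaves one of them unhit. The other cases use windows
      chosen likewise.\<close>
    show ?thesis using y(1) h3[of 1] h3[of 5] h3[of 8] h3[of 11]
      unfolding 1 by (elim insertE) (simp_all add: insert_Diff_if)
  next
    case 2
    show ?thesis using y(1) h3[of 1] h3[of 5] h3[of 8] h3[of 11]
      unfolding 2 by (elim insertE) (simp_all add: insert_Diff_if)
  next
    case 3
    show ?thesis using y(1) h3[of 1] h3[of 5] h3[of 8] h3[of 11]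
      unfolding 3 by (elim insertE) (simp_all add: insert_Diff_if)
  next
    case 4
    show ?thesis using y(1) h3[of 1] h3[of 4] h3[of 8] h3[of 11]
      unfolding 4 by (elim insertE) (simp_all add: insert_Diff_if)
  next
    case 5
    show ?thesis using y(1) h3[of 1] h3[of 4] h3[of 7] h3[of 11]
      unfolding 5 by (elim insertE) (simp_all add: insert_Diff_if)
  qed
qed

section \<open>From an online rule to a single sequence of positions\<close>

lemma no_online_rule:
  fixes F :: "'c rule"
  assumes C: "card C = 15" and rule: "is_rule F" and online: "online F"
    and wJR: "always_satisfies F all_rank_wJR
      (\<lambda>n C' T P. n = 15 \<and> C' = C \<and> static_profile n T P \<and> strict_euclidean n T P \<and>
         common_axis n C' T P \<and> common_single_crossing n C' T P)"
  shows False
proof -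
  have fin: "finite C" using C by (metis card.infinite zero_neq_numeral)
  obtain ys where ys: "set ys = C" "distinct ys" using finite_distinct_list[OF fin] by blast
  obtain pos where "bij_betw pos C {1..15::nat}"
    using finite_same_card_bij[OF fin, of "{1..15::nat}"] C by auto
  then interpret line_profile 15 pos ys
    using ys by unfold_locales auto
  \<comment> \<open>Horizon 5 is the longest one used; by onlineness its outcome extends those at
    horizons 3 and 4.\<close>
  define w where "w j = pos (F 15 C 5 P j)" for j
  have "\<exists>j\<in>{1..T}. w j \<in> {l..l + (7 - T)}"
    if T: "T \<in> {3, 4, 5}" and l: "l \<in> {1..8 + T}" for T l
  proof -
    have prof: "is_profile 15 C T P" "is_profile 15 C 5 P"
      using is_profile[of T] is_profile[of 5] T ys by auto
    then have "all_rank_wJR 15 C T P (F 15 C T P)"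
      using wJR static euclidean common_axis common_single_crossing ys(1)
      unfolding always_satisfies_def by blast
    \<comment> \<open>Windows have length \<open>8 - T\<close>: the products 5 * 3, 4 * 4 and 3 * 5
      all reach 15.\<close>
    moreover have "15 \<le> (Suc (l + (7 - T)) - l) * T" using T by auto
    ultimately have "\<exists>j\<in>{1..T}. pos (F 15 C T P j) \<in> {l..l + (7 - T)}"
      using T l ys by (intro window_hit) auto
    moreover have "F 15 C T P j = F 15 C 5 P j" if "j \<in> {1..T}" for j
    proof -
      have "j \<in> {1..5}" using T that by auto
      then show ?thesis using online prof that unfolding online_def by blast
    qed
    ultimately show ?thesis unfolding w_def by auto
  qed
  then show False by (rule windows_not_all_hit)
qed

text \<open>Infinitely many potential candidates supply a set of size 15 for the first conjunct; the
  second fixes such a set and asks for the axiom only on the narrower class.\<close>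

theorem theorem5p8:
  shows "(infinite (UNIV :: 'c set) \<longrightarrow>
      \<not> (\<exists>F :: 'c rule. is_rule F \<and> online F \<and>
            always_satisfies F all_rank_wJR
              (\<lambda>n C T P. static_profile n T P \<and> strict_euclidean n T P)))
    \<and>
    (\<forall>C0 :: 'd set. card C0 = 15 \<longrightarrow>
      \<not> (\<exists>F :: 'd rule. is_rule F \<and> online F \<and>
            always_satisfies F all_rank_wJR
              (\<lambda>n C T P. n = 15 \<and> C = C0 \<and>
                 static_profile n T P \<and> strict_euclidean n T P \<and>
                 common_axis n C T P \<and> common_single_crossing n C T P)))"
proof (intro conjI impI allI notI)
  assume "infinite (UNIV :: 'c set)"
  then obtain C :: "'c set" where C: "card C = 15"
    using infinite_arbitrarily_large by blast
  assume "\<exists>F :: 'c rule. is_rule F \<and> online F \<and>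
      always_satisfies F all_rank_wJR
        (\<lambda>n C T P. static_profile n T P \<and> strict_euclidean n T P)"
  then obtain F :: "'c rule" where F: "is_rule F" "online F"
    "always_satisfies F all_rank_wJR
        (\<lambda>n C T P. static_profile n T P \<and> strict_euclidean n T P)"
    by blast
  show False
    by (rule no_online_rule[OF C F(1,2)]) (use F(3) in \<open>auto simp: always_satisfies_def\<close>)
next
  fix C0 :: "'d set"
  assume C0: "card C0 = 15" and "\<exists>F :: 'd rule. is_rule F \<and> online F \<and>
      always_satisfies F all_rank_wJR
        (\<lambda>n C T P. n = 15 \<and> C = C0 \<and>
           static_profile n T P \<and> strict_euclidean n T P \<and>
           common_axis n C T P \<and> common_single_crossing n C T P)"
  then show False by (elim exE conjE) (rule no_online_rule[OF C0])
qed

end
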